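(* Let $\varepsilon\in(0,1)$, let $k\ge 0$ be an integer and $m=k+1$. Consider an instance of Risky Stochastic Knapsack in which every item satisfies $\mu_i\le\varepsilon$. Consider the following $k$-semi-adaptive policy with parameters $\alpha_1=\dots=\alpha_m=\frac{1}{m+1}$: sort items so that $\frac{w_1}{\mu_1}\ge\dots\ge\frac{w_n}{\mu_n}$; set $Y_0=0$ and $\ell=1$; for $i=1,\dots,m$: start with $B_i=\emptyset$, and while $\mu(B_i)+\mu_\ell\le\alpha_i(1-Y_{i-1})$ add item $\ell$ to $B_i$ and increase $\ell$ by one; then insert all items of $B_i$ into the knapsack, observe the knapsack, and set $Y_i=Y_{i-1}+S(B_i)$, where $S(B_i)=\sum_{j\in B_i}S_j$ (execution ends at the first overflow). Then the expected value obtained by this policy is at least $$\Phi(1)\left[\left(\frac{k+1}{k+2}\right)^{k+2}-(k+1)\varepsilon\right].$$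
   Context: Stochastic Knapsack: an instance consists of $n$ items; item $i$ has a deterministic value $v_i\ge 0$ and a random nonnegative size $S_i$ drawn from a known distribution, independently across items. The knapsack capacity is $1$. A policy inserts items one at a time (each at most once) and may stop; execution ends when the policy stops or at the first overflow (total realized size of inserted items exceeds $1$). In Risky Stochastic Knapsack, an overflow yields total value $0$; otherwise the policy receives the sum of the values of inserted items. An adaptive query is a step at which the policy observes the current total realized size of inserted items; a $k$-semi-adaptive policy makes at most $k$ such queries. Effective value $w_i=v_i\Pr(S_i\le 1)$; mean truncated size $\mu_i=\mathbb{E}[\min(S_i,1)]$; $\mu(A)=\sum_{i\in A}\mu_i$. For $t\ge0$, $\Phi(t)=\max\{\sum_i x_iw_i:\sum_i x_i\mu_i\le t,\ x_i\in[0,1]\}$. *)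

theory Defs
  imports "HOL-Probability.Probability"
begin

section \<open>Instances\<close>

text \<open>A finite set \<open>I\<close> of items with deterministic values \<open>v\<close> and independent nonnegative random
  sizes \<open>S\<close>; the knapsack capacity is \<open>1\<close>.\<close>

locale stochastic_knapsack = prob_space M for M :: "'a measure" +
  fixes I :: "'i set"
    and v :: "'i \<Rightarrow> real"
    and S :: "'i \<Rightarrow> 'a \<Rightarrow> real"
  assumes finite_items: "finite I"
    and value_nonneg: "i \<in> I \<Longrightarrow> 0 \<le> v i"
    and size_nonneg: "i \<in> I \<Longrightarrow> AE \<omega> in M. 0 \<le> S i \<omega>"
    and sizes_indep: "indep_vars (\<lambda>_. borel) S I"

definition effective_value :: "'a measure \<Rightarrow> ('i \<Rightarrow> real) \<Rightarrow> ('i \<Rightarrow> 'a \<Rightarrow> real) \<Rightarrow> 'i \<Rightarrow> real"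
  where "effective_value M v S i = v i * measure M {\<omega> \<in> space M. S i \<omega> \<le> 1}"

definition mean_truncated_size :: "'a measure \<Rightarrow> ('i \<Rightarrow> 'a \<Rightarrow> real) \<Rightarrow> 'i \<Rightarrow> real"
  where "mean_truncated_size M S i = (\<integral>\<omega>. min (S i \<omega>) 1 \<partial>M)"

definition feasible_fractional :: "'i set \<Rightarrow> ('i \<Rightarrow> real) \<Rightarrow> real \<Rightarrow> ('i \<Rightarrow> real) set"
  where "feasible_fractional I \<mu> t = {x. (\<forall>i\<in>I. 0 \<le> x i \<and> x i \<le> 1) \<and> (\<Sum>i\<in>I. x i * \<mu> i) \<le> t}"

text \<open>The supremum is a maximum for \<open>t \<ge> 0\<close>: see \<open>fractional_opt_attained\<close> below.\<close>

definition fractional_opt :: "'i set \<Rightarrow> ('i \<Rightarrow> real) \<Rightarrow> ('i \<Rightarrow> real) \<Rightarrow> real \<Rightarrow> real"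
  where "fractional_opt I w \<mu> t = (SUP x \<in> feasible_fractional I \<mu> t. \<Sum>i\<in>I. x i * w i)"

lemma fractional_opt_attained:
  assumes I: "finite I" and t: "0 \<le> t"
  shows "\<exists>x \<in> feasible_fractional I \<mu> t. fractional_opt I w \<mu> t = (\<Sum>i\<in>I. x i * w i) \<and>
           (\<forall>y \<in> feasible_fractional I \<mu> t. (\<Sum>i\<in>I. y i * w i) \<le> (\<Sum>i\<in>I. x i * w i))"
proof -
  define A where "A = (\<lambda>i. if i \<in> I then {0..1} else {0::real})"
  define K where "K = PiE UNIV A \<inter> {x. (\<Sum>i\<in>I. x i * \<mu> i) \<le> t}"
  have cont: "continuous_on UNIV (\<lambda>x. \<Sum>i\<in>I. x i * c i)" for c :: "'a \<Rightarrow> real"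
    by (intro continuous_intros continuous_on_product_coordinates)
  have "compactin (product_topology (\<lambda>i::'a. euclidean :: real topology) UNIV) (PiE UNIV A)"
    by (subst compactin_PiE) (auto simp: A_def)
  then have "compact (PiE UNIV A)"
    by (simp add: euclidean_product_topology)
  moreover have "closed {x. (\<Sum>i\<in>I. x i * \<mu> i) \<le> t}"
    by (intro closed_Collect_le cont continuous_on_const)
  ultimately have "compact K"
    unfolding K_def by (rule compact_Int_closed)
  moreover have "(\<lambda>_. 0) \<in> K"
    using t by (auto simp: K_def A_def)
  ultimately obtain x where x: "x \<in> K" "\<forall>y\<in>K. (\<Sum>i\<in>I. y i * w i) \<le> (\<Sum>i\<in>I. x i * w i)"
    using continuous_attains_sup[of K "\<lambda>x. \<Sum>i\<in>I. x i * w i"]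
      continuous_on_subset[OF cont subset_UNIV] by blast
  have xf: "x \<in> feasible_fractional I \<mu> t"
  proof -
    have "x i \<in> A i" for i
      using x(1) by (auto simp: K_def)
    then have "0 \<le> x i \<and> x i \<le> 1" if "i \<in> I" for i
      using that by (metis A_def atLeastAtMost_iff)
    then show ?thesis
      using x(1) by (simp add: K_def feasible_fractional_def)
  qed
  have le: "(\<Sum>i\<in>I. y i * w i) \<le> (\<Sum>i\<in>I. x i * w i)" if y: "y \<in> feasible_fractional I \<mu> t" for y
  proof -
    define z where "z = (\<lambda>i. if i \<in> I then y i else 0)"
    have eq: "(\<Sum>i\<in>I. z i * c i) = (\<Sum>i\<in>I. y i * c i)" for c
      by (rule sum.cong) (auto simp: z_def)
    have "z i \<in> A i" for i
      using y by (simp add: A_def z_def feasible_fractional_def)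
    moreover have "(\<Sum>i\<in>I. z i * \<mu> i) \<le> t"
      using y by (simp add: eq feasible_fractional_def)
    ultimately have "z \<in> K"
      by (simp add: K_def PiE_iff)
    then show ?thesis
      using x(2) eq[of w] by fastforce
  qed
  have "fractional_opt I w \<mu> t = (\<Sum>i\<in>I. x i * w i)"
    unfolding fractional_opt_def using xf le by (intro cSup_eq_maximum) auto
  then show ?thesis
    using xf le by blast
qed

section \<open>Policies\<close>

text \<open>A policy is a decision tree. It learns about the realized sizes only through \<open>Query\<close> nodes,
  at which it branches on the current total realized size of the inserted items.\<close>

datatype 'i policy = Stop | Insert 'i "'i policy" | Query "real \<Rightarrow> 'i policy"

text \<open>Policies that insert each item of \<open>A\<close> at most once, and no other item, and make at most \<open>k\<close>
  adaptive queries.\<close>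

inductive semi_adaptive :: "nat \<Rightarrow> 'i set \<Rightarrow> 'i policy \<Rightarrow> bool" where
  "semi_adaptive k A Stop"
| "i \<in> A \<Longrightarrow> semi_adaptive k (A - {i}) p \<Longrightarrow> semi_adaptive k A (Insert i p)"
| "(\<And>y. semi_adaptive k A (f y)) \<Longrightarrow> semi_adaptive (Suc k) A (Query f)"

text \<open>Total value in Risky Stochastic Knapsack under the realization \<open>s\<close> of the sizes, where \<open>y\<close> and
  \<open>u\<close> are the total realized size and the total value of the items inserted so far.\<close>

primrec risky_value :: "('i \<Rightarrow> real) \<Rightarrow> ('i \<Rightarrow> real) \<Rightarrow> 'i policy \<Rightarrow> real \<Rightarrow> real \<Rightarrow> real" where
  "risky_value v s Stop y u = u"
| "risky_value v s (Insert i p) y u =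
     (if y + s i > 1 then 0 else risky_value v s p (y + s i) (u + v i))"
| "risky_value v s (Query f) y u = risky_value v s (f y) y u"

definition expected_risky_value ::
    "'a measure \<Rightarrow> ('i \<Rightarrow> real) \<Rightarrow> ('i \<Rightarrow> 'a \<Rightarrow> real) \<Rightarrow> 'i policy \<Rightarrow> real"
  where "expected_risky_value M v S p = (\<integral>\<omega>. risky_value v (\<lambda>i. S i \<omega>) p 0 0 \<partial>M)"

section \<open>The greedy batch policy\<close>

text \<open>The quotients are taken in the extended reals, so that an item with \<open>\<mu> i = 0\<close> and
  \<open>w i > 0\<close> has density \<open>\<infinity>\<close>; there \<open>0 / 0 = 0\<close>.\<close>

definition density_sorted :: "('i \<Rightarrow> real) \<Rightarrow> ('i \<Rightarrow> real) \<Rightarrow> 'i list \<Rightarrow> bool"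
  where "density_sorted w \<mu> ls \<longleftrightarrow>
    sorted_wrt (\<lambda>i j. ereal (w i) / ereal (\<mu> i) \<ge> ereal (w j) / ereal (\<mu> j)) ls"

text \<open>The while loop that fills a batch \<open>B\<close> up to the budget \<open>c\<close>; it returns the batch and the
  remaining items.\<close>

fun fill_batch :: "('i \<Rightarrow> real) \<Rightarrow> real \<Rightarrow> 'i list \<Rightarrow> 'i list \<Rightarrow> 'i list \<times> 'i list" where
  "fill_batch \<mu> c B [] = (B, [])"
| "fill_batch \<mu> c B (l # ls) =
     (if (\<Sum>j\<in>set B. \<mu> j) + \<mu> l \<le> c then fill_batch \<mu> c (B @ [l]) ls else (B, l # ls))"

text \<open>The list \<open>\<alpha> # \<alpha>s\<close> holds the parameters of the batches still to be inserted, \<open>ls\<close> the remaining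
  items and \<open>y\<close> the last observed total size. An observation after the last batch would not be
  used by the policy, so it is not made: \<open>m\<close> batches take \<open>m - 1\<close> queries.\<close>

primrec batch_policy :: "('i \<Rightarrow> real) \<Rightarrow> real list \<Rightarrow> 'i list \<Rightarrow> real \<Rightarrow> 'i policy" where
  "batch_policy \<mu> [] ls y = Stop"
| "batch_policy \<mu> (\<alpha> # \<alpha>s) ls y =
     (let (B, ls') = fill_batch \<mu> (\<alpha> * (1 - y)) [] ls
      in foldr Insert B (if \<alpha>s = [] then Stop else Query (\<lambda>y'. batch_policy \<mu> \<alpha>s ls' y')))"

lemma fill_batch_append: "fill_batch \<mu> c B ls = (B', ls') \<Longrightarrow> B' @ ls' = B @ ls"
  by (induction \<mu> c B ls rule: fill_batch.induct) (auto split: if_splits)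

lemma semi_adaptive_foldr_Insert:
  "distinct B \<Longrightarrow> set B \<subseteq> A \<Longrightarrow> semi_adaptive k (A - set B) p \<Longrightarrow> semi_adaptive k A (foldr Insert B p)"
proof (induction B arbitrary: A)
  case (Cons b B)
  have "A - set (b # B) = A - {b} - set B" by auto
  with Cons show ?case by (auto intro!: semi_adaptive.intros Cons.IH)
qed simp

lemma semi_adaptive_batch_policy:
  "length \<alpha>s \<le> Suc k \<Longrightarrow> distinct ls \<Longrightarrow> set ls \<subseteq> A \<Longrightarrow> semi_adaptive k A (batch_policy \<mu> \<alpha>s ls y)"
proof (induction \<alpha>s arbitrary: k ls A y)
  case Nil
  then show ?case by (auto intro: semi_adaptive.intros)
next
  case (Cons \<alpha> \<alpha>s)
  obtain B ls' where fill: "fill_batch \<mu> (\<alpha> * (1 - y)) [] ls = (B, ls')"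
    by fastforce
  from fill_batch_append[OF fill] have ls: "ls = B @ ls'" by simp
  have "semi_adaptive k (A - set B)
      (if \<alpha>s = [] then Stop else Query (\<lambda>y'. batch_policy \<mu> \<alpha>s ls' y'))"
  proof (cases "\<alpha>s = []")
    case True
    then show ?thesis by (auto intro: semi_adaptive.intros)
  next
    case False
    with Cons.prems(1) obtain k' where k: "k = Suc k'"
      by (cases k) auto
    show ?thesis
      using False Cons.prems unfolding k
      by (auto simp: ls intro!: semi_adaptive.intros Cons.IH)
  qed
  moreover have "distinct B" "set B \<subseteq> A"
    using Cons.prems by (auto simp: ls)
  ultimately show ?case
    by (simp add: fill semi_adaptive_foldr_Insert)
qed

end

theory Submission
  imports Defs
begin

text \<open>
  Let \<open>z\<close> be the remaining capacity and \<open>F(T)\<close> the fractional optimum of the remaining items for the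
  budget \<open>T\<close>. A batch of mean size at most \<open>\<alpha> z\<close> fits with probability at least \<open>1 - \<alpha>\<close>, and the
  expectation of the positive part of the remaining capacity is at least \<open>(1 - \<alpha>) z\<close>, both by
  Markov-type estimates. Hence the worst case is that sizes are either zero or overflow: with \<open>r\<close>
  batches left, all of them get the budget \<open>\<alpha> z\<close> and all fit with probability \<open>(1 - \<alpha>)^r\<close>. By
  induction on \<open>r\<close>, the expected value from a state with value \<open>u\<close> collected is at least
  \<open>(1 - \<alpha>)^r u + ((1 - \<alpha>)^r r \<alpha> z - r \<epsilon>) F(T) / T\<close> for every \<open>T > r \<alpha> z\<close>. The right-hand side is
  affine in \<open>z\<close>, and the average density \<open>F(T) / T\<close> can only decrease when a greedy prefix is removed
  together with its budget; each batch wastes less than \<open>\<epsilon>\<close> of its budget.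
\<close>

section \<open>Greedy order and the fractional knapsack optimum\<close>

text \<open>Cross-multiplying removes the extended-real quotients. The left side vanishes if
  \<open>\<mu> i = 0\<close> or \<open>w j = 0\<close>; otherwise \<open>\<mu> j = 0\<close> would
  place an item \<open>j\<close> of infinite density behind \<open>i\<close> of finite density, so
  both denominators are positive.\<close>

lemma density_sorted_cross:
  assumes sorted: "density_sorted w \<mu> (B @ C)" and ij: "i \<in> set B" "j \<in> set C"
    and nn: "0 \<le> w i" "0 \<le> w j" "0 \<le> \<mu> i" "0 \<le> \<mu> j"
  shows "w j * \<mu> i \<le> w i * \<mu> j"
proof -
  have le: "ereal (w j) / ereal (\<mu> j) \<le> ereal (w i) / ereal (\<mu> i)"
    using sorted ij by (auto simp: density_sorted_def sorted_wrt_append)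
  show ?thesis
  proof (cases "\<mu> i = 0 \<or> w j = 0")
    case True
    then show ?thesis using nn by auto
  next
    case False
    then have pos: "0 < \<mu> i" "0 < w j" using nn by auto
    then have "\<mu> j \<noteq> 0"
      using le by (auto simp: divide_ereal_def)
    then show ?thesis
      using le pos nn by (auto simp: field_simps)
  qed
qed

lemma sum_le_fractional_opt:
  assumes "finite A" "0 \<le> t" "x \<in> feasible_fractional A \<mu> t"
  shows "(\<Sum>i\<in>A. x i * w i) \<le> fractional_opt A w \<mu> t"
  using fractional_opt_attained[OF assms(1,2), of \<mu> w] assms(3) by metis

lemma fractional_opt_nonneg:
  assumes "finite A" "0 \<le> t"
  shows "0 \<le> fractional_opt A w \<mu> t"
  using sum_le_fractional_opt[OF assms, of "\<lambda>_. 0" \<mu> w] assms(2)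
  by (simp add: feasible_fractional_def)

text \<open>The pairwise inequality is scaled by \<open>z i * x j\<close> and summed over all pairs:
  a comparison of average densities that tolerates zero mean sizes.\<close>

lemma sum_cross_le:
  fixes w \<mu> x z :: "'i \<Rightarrow> real"
  assumes cross: "\<And>i j. i \<in> A \<Longrightarrow> j \<in> B \<Longrightarrow> w j * \<mu> i \<le> w i * \<mu> j"
    and nn: "\<And>i. i \<in> A \<Longrightarrow> 0 \<le> z i" "\<And>j. j \<in> B \<Longrightarrow> 0 \<le> x j"
  shows "(\<Sum>i\<in>A. z i * \<mu> i) * (\<Sum>j\<in>B. x j * w j) \<le> (\<Sum>i\<in>A. z i * w i) * (\<Sum>j\<in>B. x j * \<mu> j)"
proof -
  have "z i * \<mu> i * (x j * w j) \<le> z i * w i * (x j * \<mu> j)" if "i \<in> A" "j \<in> B" for i j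
    using mult_left_mono[OF cross[OF that], of "z i * x j"] nn that by (simp add: mult_ac)
  then show ?thesis
    by (auto simp: sum_product intro!: sum_mono)
qed

text \<open>An optimal fractional choice from \<open>B\<close> is compared with all of
  \<open>A\<close> by \<open>sum_cross_le\<close>, and it spends at most \<open>t\<close>.\<close>

lemma fractional_opt_density_le:
  assumes fin: "finite B" and t: "0 \<le> t"
    and cross: "\<And>i j. i \<in> A \<Longrightarrow> j \<in> B \<Longrightarrow> w j * \<mu> i \<le> w i * \<mu> j"
    and w: "\<And>i. i \<in> A \<Longrightarrow> 0 \<le> w i"
  shows "sum \<mu> A * fractional_opt B w \<mu> t \<le> sum w A * t"
proof -
  obtain x where x: "x \<in> feasible_fractional B \<mu> t" "fractional_opt B w \<mu> t = (\<Sum>i\<in>B. x i * w i)"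
    using fractional_opt_attained[OF fin t] by metis
  have "sum \<mu> A * (\<Sum>i\<in>B. x i * w i) \<le> sum w A * (\<Sum>i\<in>B. x i * \<mu> i)"
    using sum_cross_le[of A B w \<mu> "\<lambda>_. 1" x] cross x(1) by (auto simp: feasible_fractional_def)
  also have "\<dots> \<le> sum w A * t"
    using x(1) w by (intro mult_left_mono sum_nonneg) (auto simp: feasible_fractional_def)
  finally show ?thesis using x(2) by simp
qed

text \<open>Exchange argument: \<open>A\<close> is at least as dense as \<open>B\<close> and fits
  into the budget, so an optimal solution loses nothing when capacity is moved from \<open>B\<close>
  to the unfilled part of \<open>A\<close>.\<close>

lemma fractional_opt_Un:
  assumes fin: "finite A" "finite B" and disj: "A \<inter> B = {}"
    and nn: "\<And>i. i \<in> A \<union> B \<Longrightarrow> 0 \<le> w i" "\<And>i. i \<in> A \<union> B \<Longrightarrow> 0 \<le> \<mu> i"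
    and cross: "\<And>i j. i \<in> A \<Longrightarrow> j \<in> B \<Longrightarrow> w j * \<mu> i \<le> w i * \<mu> j"
    and t: "sum \<mu> A \<le> t"
  shows "fractional_opt (A \<union> B) w \<mu> t = sum w A + fractional_opt B w \<mu> (t - sum \<mu> A)"
proof (rule antisym)
  have t0: "0 \<le> t"
    using t sum_nonneg[of A \<mu>] nn by force
  have Un: "(\<Sum>i\<in>A \<union> B. g i) = sum g A + sum g B" for g :: "_ \<Rightarrow> real"
    using fin disj by (rule sum.union_disjoint)
  let ?s = "t - sum \<mu> A"
  have s: "0 \<le> ?s" using t by simp
  obtain x where x: "x \<in> feasible_fractional (A \<union> B) \<mu> t"
      "fractional_opt (A \<union> B) w \<mu> t = (\<Sum>i\<in>A \<union> B. x i * w i)"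
    using fractional_opt_attained[of "A \<union> B" t \<mu> w] fin t0 by auto
  have x01: "0 \<le> x i" "x i \<le> 1" if "i \<in> A \<union> B" for i
    using x(1) that by (auto simp: feasible_fractional_def)
  define X where "X = (\<Sum>j\<in>B. x j * \<mu> j)"
  define V where "V = (\<Sum>j\<in>B. x j * w j)"
  have V0: "0 \<le> V" unfolding V_def using nn x01 by (intro sum_nonneg) auto
  \<comment> \<open>The total usage is at most \<open>t\<close>, so whatever \<open>B\<close> takes
    beyond \<open>?s\<close> is at most the mean size that \<open>x\<close> leaves unfilled on
    \<open>A\<close>.\<close>
  have slack: "X - ?s \<le> (\<Sum>i\<in>A. (1 - x i) * \<mu> i)"
    using x(1) by (simp add: feasible_fractional_def Un X_def sum_subtractf left_diff_distrib)
  have gain: "(\<Sum>i\<in>A. (1 - x i) * w i) = sum w A - (\<Sum>i\<in>A. x i * w i)"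
    by (simp add: sum_subtractf left_diff_distrib)
  have gain0: "0 \<le> (\<Sum>i\<in>A. (1 - x i) * w i)"
    using nn x01 by (intro sum_nonneg) auto
  have "V \<le> (\<Sum>i\<in>A. (1 - x i) * w i) + fractional_opt B w \<mu> ?s"
  proof (cases "X \<le> ?s")
    case True
    then have "V \<le> fractional_opt B w \<mu> ?s"
      unfolding V_def X_def using x01
      by (intro sum_le_fractional_opt fin s) (auto simp: feasible_fractional_def)
    then show ?thesis using gain0 by simp
  next
    case False
    then have X: "0 < X" "?s < X" using s by auto
    \<comment> \<open>Shrinking the fractions on \<open>B\<close> frees the capacity needed to complete \<open>A\<close>.\<close>
    have "(\<Sum>j\<in>B. ?s / X * x j * w j) \<le> fractional_opt B w \<mu> ?s"
    proof (intro sum_le_fractional_opt fin s)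
      have "(\<Sum>j\<in>B. ?s / X * x j * \<mu> j) = ?s / X * X"
        by (simp add: X_def sum_distrib_left mult.assoc)
      also have "\<dots> = ?s" using X by simp
      finally have "(\<Sum>j\<in>B. ?s / X * x j * \<mu> j) \<le> ?s" by simp
      moreover have "0 \<le> ?s / X" "?s / X \<le> 1" using X s by auto
      then have "0 \<le> ?s / X * x j \<and> ?s / X * x j \<le> 1" if "j \<in> B" for j
        using x01[of j] that mult_le_one[of "?s / X" "x j"]
          mult_nonneg_nonneg[of "?s / X" "x j"] by blast
      ultimately show "(\<lambda>j. ?s / X * x j) \<in> feasible_fractional B \<mu> ?s"
        unfolding feasible_fractional_def by blast
    qed
    moreover have "(\<Sum>j\<in>B. ?s / X * x j * w j) = ?s / X * V"
      by (simp add: V_def sum_distrib_left mult.assoc)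
    \<comment> \<open>Shrinking gives up capacity \<open>X - ?s\<close> at the average density
      \<open>V / X\<close> of \<open>B\<close>. By \<open>slack\<close> the missing part of
      \<open>A\<close> is at least that large, and it is at least as dense.\<close>
    moreover have "V - ?s / X * V \<le> (\<Sum>i\<in>A. (1 - x i) * w i)"
    proof -
      have "(X - ?s) * V \<le> (\<Sum>i\<in>A. (1 - x i) * \<mu> i) * V"
        using slack V0 by (rule mult_right_mono)
      also have "\<dots> \<le> (\<Sum>i\<in>A. (1 - x i) * w i) * X"
        unfolding V_def X_def using x01 cross by (intro sum_cross_le) auto
      finally show ?thesis
        using X by (simp add: field_simps)
    qed
    ultimately show ?thesis by simp
  qed
  then show "fractional_opt (A \<union> B) w \<mu> t \<le> sum w A + fractional_opt B w \<mu> ?s"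
    using x(2) gain by (simp add: Un V_def)
  obtain y where y: "y \<in> feasible_fractional B \<mu> ?s"
      "fractional_opt B w \<mu> ?s = (\<Sum>i\<in>B. y i * w i)"
    using fractional_opt_attained[OF fin(2) s] by metis
  let ?y = "\<lambda>i. if i \<in> A then 1 else y i"
  have eq: "(\<Sum>i\<in>A \<union> B. ?y i * g i) = sum g A + (\<Sum>i\<in>B. y i * g i)" for g
  proof -
    have "(\<Sum>i\<in>B. ?y i * g i) = (\<Sum>i\<in>B. y i * g i)"
      using disj by (intro sum.cong) auto
    then show ?thesis by (simp add: Un)
  qed
  have "(\<Sum>i\<in>A \<union> B. ?y i * w i) \<le> fractional_opt (A \<union> B) w \<mu> t"
    using y(1) fin t0
    by (intro sum_le_fractional_opt) (auto simp: feasible_fractional_def eq)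
  then show "sum w A + fractional_opt B w \<mu> ?s \<le> fractional_opt (A \<union> B) w \<mu> t"
    using y(2) eq by simp
qed

section \<open>The filling loop and measurability of the policy's value\<close>

lemma fill_batch_le:
  "fill_batch \<mu> c B ls = (B', ls') \<Longrightarrow> sum \<mu> (set B) \<le> c \<Longrightarrow> (\<And>l. l \<in> set ls \<Longrightarrow> 0 \<le> \<mu> l) \<Longrightarrow>
    sum \<mu> (set B') \<le> c"
proof (induction \<mu> c B ls rule: fill_batch.induct)
  case (2 \<mu> c B l ls)
  \<comment> \<open>The loop sums over the set of the batch: a repeated item leaves the sum
    unchanged, and then \<open>0 \<le> \<mu> l\<close> gives the inequality.\<close>
  have "sum \<mu> (set (B @ [l])) \<le> sum \<mu> (set B) + \<mu> l"
    using 2(4) by (cases "l \<in> set B") (auto simp: insert_absorb)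
  with 2 show ?case by (auto split: if_splits)
qed simp

text \<open>If items are left over, the loop test failed at the first of them. This limits the
  wasted budget of a batch to less than one mean size, hence to less than
  \<open>\<epsilon>\<close>.\<close>

lemma fill_batch_full:
  "fill_batch \<mu> c B ls = (B', ls') \<Longrightarrow> ls' \<noteq> [] \<Longrightarrow> c < sum \<mu> (set B') + \<mu> (hd ls')"
  by (induction \<mu> c B ls rule: fill_batch.induct) (auto split: if_splits)

text \<open>The budget is random, but the list has only finitely many splits, and unrolling the loop
  gives nested measurable case distinctions. So measurability for each fixed split suffices.\<close>

lemma measurable_fill_batch:
  assumes "c \<in> borel_measurable N"
    and "\<And>B' ls'. B' @ ls' = B @ ls \<Longrightarrow> h B' ls' \<in> borel_measurable N"
  shows "(\<lambda>n. case fill_batch \<mu> (c n) B ls of (B', ls') \<Rightarrow> h B' ls' n) \<in> borel_measurable N"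
  using assms(2)
proof (induction ls arbitrary: B)
  case (Cons l ls)
  have [measurable]: "(\<lambda>n. case fill_batch \<mu> (c n) (B @ [l]) ls of (B', ls') \<Rightarrow> h B' ls' n) \<in> borel_measurable N"
    by (rule Cons.IH) (simp add: Cons.prems)
  have [measurable]: "h B (l # ls) \<in> borel_measurable N" "c \<in> borel_measurable N"
    using Cons.prems assms(1) by auto
  have "(\<lambda>n. case fill_batch \<mu> (c n) B (l # ls) of (B', ls') \<Rightarrow> h B' ls' n) =
    (\<lambda>n. if sum \<mu> (set B) + \<mu> l \<le> c n
         then case fill_batch \<mu> (c n) (B @ [l]) ls of (B', ls') \<Rightarrow> h B' ls' n else h B (l # ls) n)"
    by (auto simp: fun_eq_iff)
  then show ?case by simp
qed simp

lemma measurable_risky_value_foldr_Insert: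
  assumes "\<And>Y u. Y \<in> borel_measurable N \<Longrightarrow> (\<lambda>n. risky_value v (s n) p (Y n) u) \<in> borel_measurable N"
    and "\<And>i. i \<in> set B \<Longrightarrow> (\<lambda>n. s n i) \<in> borel_measurable N"
    and "Y \<in> borel_measurable N"
  shows "(\<lambda>n. risky_value v (s n) (foldr Insert B p) (Y n) u) \<in> borel_measurable N"
  using assms(2,3)
proof (induction B arbitrary: Y u)
  case Nil
  then show ?case using assms(1) by simp
next
  case (Cons b B)
  have [measurable]: "(\<lambda>n. s n b) \<in> borel_measurable N" "Y \<in> borel_measurable N"
    using Cons.prems by auto
  have [measurable]: "(\<lambda>n. risky_value v (s n) (foldr Insert B p) (Y n + s n b) (u + v b)) \<in> borel_measurable N"
    by (rule Cons.IH) (auto simp: Cons.prems)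
  show ?case by simp
qed

text \<open>The policy omits the query after its last batch. A query followed by \<open>Stop\<close>
  does not change the value, so all batches can be treated alike.\<close>

lemma risky_value_batch_policy_Cons:
  "risky_value v s (batch_policy \<mu> (\<alpha> # \<alpha>s) ls y) y' u =
    (case fill_batch \<mu> (\<alpha> * (1 - y)) [] ls of (B, ls') \<Rightarrow>
      risky_value v s (foldr Insert B (Query (\<lambda>y''. batch_policy \<mu> \<alpha>s ls' y''))) y' u)"
proof -
  have "risky_value v s (foldr Insert B Stop) y u = risky_value v s (foldr Insert B (Query (\<lambda>_. Stop))) y u"
    for B y u by (induction B arbitrary: y u) auto
  then show ?thesis
    by (simp split: prod.splits)
qed

text \<open>The size \<open>Y\<close> must be a measurable function rather than a constant, since
  after a batch both the running total and the next budget depend on it. The space \<open>N\<close>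
  is later the sample space as well as a product space of size vectors.\<close>

lemma measurable_risky_value_batch_policy:
  assumes "Y \<in> borel_measurable N"
    and "\<And>i. i \<in> set ls \<Longrightarrow> (\<lambda>n. s n i) \<in> borel_measurable N"
  shows "(\<lambda>n. risky_value v (s n) (batch_policy \<mu> \<alpha>s ls (Y n)) (Y n) u) \<in> borel_measurable N"
  using assms
proof (induction \<alpha>s arbitrary: ls Y u)
  case (Cons \<alpha> \<alpha>s)
  have [measurable]: "Y \<in> borel_measurable N" by fact
  have "(\<lambda>n. risky_value v (s n) (foldr Insert B (Query (\<lambda>y''. batch_policy \<mu> \<alpha>s ls' y''))) (Y n) u)
    \<in> borel_measurable N" if "B @ ls' = ls" for B ls'
  proof (rule measurable_risky_value_foldr_Insert)
    fix Y :: "_ \<Rightarrow> real" and u assume Y: "Y \<in> borel_measurable N"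
    show "(\<lambda>n. risky_value v (s n) (Query (\<lambda>y''. batch_policy \<mu> \<alpha>s ls' y'')) (Y n) u)
      \<in> borel_measurable N"
      using Cons.IH[OF Y, of ls' u] Cons.prems(2) that by auto
  qed (use Cons.prems that in auto)
  then show ?case
    unfolding risky_value_batch_policy_Cons
    by (intro measurable_fill_batch) auto
qed simp

section \<open>The policy's value under a fixed realization\<close>

text \<open>With nonnegative sizes the running total only grows, so some insertion overflows exactly
  if the whole batch does; a batch acts like one large item. The assumption \<open>y \<le> 1\<close>
  covers the empty batch, which never overflows.\<close>

lemma risky_value_foldr_Insert:
  assumes "\<And>i. i \<in> set B \<Longrightarrow> 0 \<le> s i" "distinct B" "y \<le> 1"
  shows "risky_value v s (foldr Insert B p) y u =
    (if y + sum s (set B) > 1 then 0 else risky_value v s p (y + sum s (set B)) (u + sum v (set B)))"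
  using assms
proof (induction B arbitrary: y u)
  case (Cons b B)
  have "0 \<le> sum s (set B)" using Cons.prems by (intro sum_nonneg) auto
  with Cons show ?case by (auto simp: add.assoc)
qed simp

text \<open>These bounds supply integrability. They hold for every \<open>s\<close>, whatever its
  signs, so that the value is bounded everywhere on the space of size vectors.\<close>

lemma risky_value_bounds:
  assumes "\<And>i. i \<in> set ls \<Longrightarrow> 0 \<le> v i" "0 \<le> u"
  shows "0 \<le> risky_value v s (batch_policy \<mu> \<alpha>s ls y) y u \<and>
    risky_value v s (batch_policy \<mu> \<alpha>s ls y) y u \<le> u + sum_list (map v ls)"
  using assms
proof (induction \<alpha>s arbitrary: ls y u)
  case Nil
  then show ?case by (auto intro!: sum_list_nonneg)
next
  case (Cons \<alpha> \<alpha>s)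
  obtain B ls' where fill: "fill_batch \<mu> (\<alpha> * (1 - y)) [] ls = (B, ls')"
    by fastforce
  from fill_batch_append[OF fill] have ls: "ls = B @ ls'" by simp
  have IH: "0 \<le> risky_value v s (Query (batch_policy \<mu> \<alpha>s ls')) y u \<and>
    risky_value v s (Query (batch_policy \<mu> \<alpha>s ls')) y u \<le> u + sum_list (map v ls')" if "0 \<le> u" for y u
    using Cons.IH[of ls' u y] Cons.prems that by (simp add: ls)
  have nn: "0 \<le> sum_list (map v ls')"
    using Cons.prems by (intro sum_list_nonneg) (auto simp: ls)
  have "\<forall>i\<in>set B. 0 \<le> v i" using Cons.prems by (auto simp: ls)
  then have "0 \<le> risky_value v s (foldr Insert B (Query (batch_policy \<mu> \<alpha>s ls'))) y' u \<and>
    risky_value v s (foldr Insert B (Query (batch_policy \<mu> \<alpha>s ls'))) y' u \<le> u + sum_list (map v (B @ ls'))"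
    if "0 \<le> u" for y'
    using that
  proof (induction B arbitrary: y' u)
    case Nil
    then show ?case using IH by simp
  next
    case (Cons b B)
    have "0 \<le> sum_list (map v B)" using Cons.prems by (intro sum_list_nonneg) auto
    with Cons.IH[of "u + v b" "y' + s b"] Cons.prems nn show ?case by simp
  qed
  with Cons.prems show ?case
    unfolding risky_value_batch_policy_Cons using fill by (simp add: ls)
qed

text \<open>This allows the full realization to be replaced by its restriction to the remaining
  items, which is independent of the batch.\<close>

lemma risky_value_cong:
  assumes "\<And>i. i \<in> set ls \<Longrightarrow> s i = s' i"
  shows "risky_value v s (batch_policy \<mu> \<alpha>s ls y) y' u = risky_value v s' (batch_policy \<mu> \<alpha>s ls y) y' u"
  using assms
proof (induction \<alpha>s arbitrary: ls y y' u)
  case (Cons \<alpha> \<alpha>s)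
  obtain B ls' where fill: "fill_batch \<mu> (\<alpha> * (1 - y)) [] ls = (B, ls')"
    by fastforce
  from fill_batch_append[OF fill] have ls: "ls = B @ ls'" by simp
  have IH: "risky_value v s (Query (batch_policy \<mu> \<alpha>s ls')) y u =
    risky_value v s' (Query (batch_policy \<mu> \<alpha>s ls')) y u" for y u
    using Cons.IH[of ls' y y u] Cons.prems by (simp add: ls)
  have "\<forall>i\<in>set B. s i = s' i" using Cons.prems by (auto simp: ls)
  then have "risky_value v s (foldr Insert B (Query (batch_policy \<mu> \<alpha>s ls'))) y' u =
    risky_value v s' (foldr Insert B (Query (batch_policy \<mu> \<alpha>s ls'))) y' u"
    by (induction B arbitrary: y' u) (use IH in auto)
  then show ?case
    unfolding risky_value_batch_policy_Cons by (simp add: fill)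
qed simp

section \<open>Iterated expectation for independent variables\<close>

text \<open>Fubini for the joint law, which independence makes the product of the marginals. Both
  integrals are pulled back to \<open>M\<close>, so that the inner one is again an expectation over
  the original sizes.\<close>

lemma (in prob_space) indep_var_iterated_integral:
  fixes g :: "_ \<Rightarrow> real"
  assumes indep: "indep_var N1 X N2 Y"
    and g: "g \<in> borel_measurable (N1 \<Otimes>\<^sub>M N2)" and bound: "\<And>z. \<bar>g z\<bar> \<le> C"
  shows "(\<integral>\<omega>. g (X \<omega>, Y \<omega>) \<partial>M) = (\<integral>\<omega>. (\<integral>\<omega>'. g (X \<omega>, Y \<omega>') \<partial>M) \<partial>M)"
    and "(\<lambda>\<omega>. \<integral>\<omega>'. g (X \<omega>, Y \<omega>') \<partial>M) \<in> borel_measurable M"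
proof -
  note [measurable] = g
  have [measurable]: "X \<in> measurable M N1" "Y \<in> measurable M N2"
    using indep by (auto dest: indep_var_rv1 indep_var_rv2)
  interpret X: prob_space "distr M N1 X" by (rule prob_space_distr) simp
  interpret Y: prob_space "distr M N2 Y" by (rule prob_space_distr) simp
  interpret XY: pair_prob_space "distr M N1 X" "distr M N2 Y" ..
  have inner: "(\<integral>y. g (x, y) \<partial>distr M N2 Y) = (\<integral>\<omega>'. g (x, Y \<omega>') \<partial>M)" if "x \<in> space N1" for x
    using that by (intro integral_distr) auto
  have outer: "(\<lambda>x. \<integral>y. g (x, y) \<partial>distr M N2 Y) \<in> borel_measurable N1"
    by (rule Y.borel_measurable_lebesgue_integral) simp
  have "(\<integral>\<omega>. g (X \<omega>, Y \<omega>) \<partial>M) = (\<integral>z. g z \<partial>distr M (N1 \<Otimes>\<^sub>M N2) (\<lambda>\<omega>. (X \<omega>, Y \<omega>)))"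
    by (subst integral_distr) auto
  also have "\<dots> = (\<integral>z. g z \<partial>(distr M N1 X \<Otimes>\<^sub>M distr M N2 Y))"
    using indep by (simp add: indep_var_distribution_eq)
  also have "\<dots> = (\<integral>x. (\<integral>y. g (x, y) \<partial>distr M N2 Y) \<partial>distr M N1 X)"
    by (intro XY.integral_fst'[symmetric] XY.P.integrable_const_bound[where B = C]) (auto simp: bound)
  also have "\<dots> = (\<integral>\<omega>. (\<integral>y. g (X \<omega>, y) \<partial>distr M N2 Y) \<partial>M)"
    using outer by (subst integral_distr) auto
  also have "\<dots> = (\<integral>\<omega>. (\<integral>\<omega>'. g (X \<omega>, Y \<omega>') \<partial>M) \<partial>M)"
    by (intro Bochner_Integration.integral_cong refl inner measurable_space[of X M N1]) auto
  finally show "(\<integral>\<omega>. g (X \<omega>, Y \<omega>) \<partial>M) = (\<integral>\<omega>. (\<integral>\<omega>'. g (X \<omega>, Y \<omega>') \<partial>M) \<partial>M)" .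
  have "(\<lambda>\<omega>. \<integral>y. g (X \<omega>, y) \<partial>distr M N2 Y) \<in> borel_measurable M"
    using outer by measurable
  also have "?this \<longleftrightarrow> (\<lambda>\<omega>. \<integral>\<omega>'. g (X \<omega>, Y \<omega>') \<partial>M) \<in> borel_measurable M"
    by (intro measurable_cong inner measurable_space[of X M N1]) auto
  finally show "(\<lambda>\<omega>. \<integral>\<omega>'. g (X \<omega>, Y \<omega>') \<partial>M) \<in> borel_measurable M" .
qed

section \<open>Markov-type estimates for one batch\<close>

context stochastic_knapsack
begin

abbreviation "\<mu> \<equiv> mean_truncated_size M S"
abbreviation "w \<equiv> effective_value M v S"

lemma measurable_size [measurable (raw)]: "i \<in> I \<Longrightarrow> S i \<in> borel_measurable M"
  using sizes_indep by (auto simp: indep_vars_def)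

lemma AE_sizes_nonneg: "AE \<omega> in M. \<forall>i\<in>I. 0 \<le> S i \<omega>"
  using finite_items size_nonneg by (simp add: AE_finite_all)

lemma integrable_truncated_size:
  assumes "i \<in> I"
  shows "integrable M (\<lambda>\<omega>. min (S i \<omega>) 1)"
proof (rule integrable_const_bound[where B = 1])
  show "AE \<omega> in M. norm (min (S i \<omega>) 1) \<le> 1"
    using size_nonneg[OF assms] by eventually_elim auto
qed (use assms in measurable)

lemma mean_truncated_size_nonneg: "i \<in> I \<Longrightarrow> 0 \<le> \<mu> i"
  unfolding mean_truncated_size_def using size_nonneg by (intro integral_nonneg_AE) auto

lemma effective_value_nonneg: "i \<in> I \<Longrightarrow> 0 \<le> w i"
  by (simp add: effective_value_def value_nonneg)

lemma effective_value_le: "i \<in> I \<Longrightarrow> w i \<le> v i"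
  by (simp add: effective_value_def value_nonneg mult_left_le)

text \<open>Truncation does no harm because \<open>z \<le> 1\<close>: if no size exceeds
  \<open>1\<close>, the truncated sum is the true one; otherwise it is at least \<open>1\<close>,
  and \<open>z\<close> minus it is at most \<open>0\<close>. Taking expectations of this pointwise
  bound gives the claim.\<close>

lemma expected_slack_ge:
  assumes B: "B \<subseteq> I" and z: "z \<le> 1" and b: "sum \<mu> B \<le> \<alpha> * z"
  shows "(1 - \<alpha>) * z \<le> (\<integral>\<omega>. max 0 (z - (\<Sum>i\<in>B. S i \<omega>)) \<partial>M)"
    and "integrable M (\<lambda>\<omega>. max 0 (z - (\<Sum>i\<in>B. S i \<omega>)))"
proof -
  have fin: "finite B" using B finite_items finite_subset by blast
  have [measurable]: "S i \<in> borel_measurable M" if "i \<in> B" for i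
    using B that by (auto intro: measurable_size)
  have trunc: "integrable M (\<lambda>\<omega>. \<Sum>i\<in>B. min (S i \<omega>) 1)"
    using B by (intro Bochner_Integration.integrable_sum integrable_truncated_size) auto
  show int: "integrable M (\<lambda>\<omega>. max 0 (z - (\<Sum>i\<in>B. S i \<omega>)))"
  proof (rule integrable_const_bound[where B = "max 0 z"])
    show "AE \<omega> in M. norm (max 0 (z - (\<Sum>i\<in>B. S i \<omega>))) \<le> max 0 z"
      using AE_sizes_nonneg
    proof eventually_elim
      case (elim \<omega>)
      then have "0 \<le> (\<Sum>i\<in>B. S i \<omega>)" using B by (intro sum_nonneg) auto
      then show ?case by auto
    qed
  qed measurable
  have "(1 - \<alpha>) * z \<le> z - sum \<mu> B" using b by (simp add: algebra_simps)
  also have "\<dots> = (\<integral>\<omega>. z - (\<Sum>i\<in>B. min (S i \<omega>) 1) \<partial>M)"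
    using trunc B
    by (simp add: mean_truncated_size_def prob_space integrable_truncated_size subset_iff)
  also have "\<dots> \<le> (\<integral>\<omega>. max 0 (z - (\<Sum>i\<in>B. S i \<omega>)) \<partial>M)"
  proof (rule integral_mono_AE)
    show "AE \<omega> in M. z - (\<Sum>i\<in>B. min (S i \<omega>) 1) \<le> max 0 (z - (\<Sum>i\<in>B. S i \<omega>))"
      using AE_sizes_nonneg
    proof eventually_elim
      case (elim \<omega>)
      show ?case
      proof (cases "\<forall>i\<in>B. S i \<omega> \<le> 1")
        case True
        then have "(\<Sum>i\<in>B. min (S i \<omega>) 1) = (\<Sum>i\<in>B. S i \<omega>)" by (intro sum.cong) auto
        then show ?thesis by simp
      next
        case False
        then obtain j where j: "j \<in> B" "1 < S j \<omega>" by force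
        have "min (S j \<omega>) 1 \<le> (\<Sum>i\<in>B. min (S i \<omega>) 1)"
          using fin j elim B by (intro member_le_sum) auto
        then show ?thesis using j z by simp
      qed
    qed
  qed (use trunc int in auto)
  finally show "(1 - \<alpha>) * z \<le> (\<integral>\<omega>. max 0 (z - (\<Sum>i\<in>B. S i \<omega>)) \<partial>M)" .
qed

text \<open>The positive part of the slack is almost surely at most \<open>z\<close> on the event
  that the batch fits and zero elsewhere, so \<open>expected_slack_ge\<close> gives the bound
  multiplied by \<open>z\<close>.\<close>

lemma prob_batch_fits_ge:
  assumes B: "B \<subseteq> I" and z: "0 \<le> z" "z \<le> 1" and \<alpha>: "0 \<le> \<alpha>" and b: "sum \<mu> B \<le> \<alpha> * z"
  shows "1 - \<alpha> \<le> prob {\<omega> \<in> space M. (\<Sum>i\<in>B. S i \<omega>) \<le> z}"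
proof (cases "z = 0")
  \<comment> \<open>Here division by \<open>z\<close> is impossible. Instead all mean truncated
    sizes in \<open>B\<close> are zero, so the batch almost surely has total size zero.\<close>
  case True
  have fin: "finite B" using B finite_items finite_subset by blast
  have nn: "0 \<le> \<mu> i" if "i \<in> B" for i
    using B that mean_truncated_size_nonneg by auto
  then have "sum \<mu> B = 0"
    using b True sum_nonneg[of B \<mu>] by simp
  then have "\<mu> i = 0" if "i \<in> B" for i
    using sum_nonneg_eq_0_iff[of B \<mu>] fin nn that by auto
  then have "AE \<omega> in M. min (S i \<omega>) 1 = 0" if "i \<in> B" for i
    using B that integral_nonneg_eq_0_iff_AE[OF integrable_truncated_size[of i]] size_nonneg[of i]
    by (auto simp: mean_truncated_size_def subset_iff)
  then have "AE \<omega> in M. \<forall>i\<in>B. min (S i \<omega>) 1 = 0"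
    using fin by (simp add: AE_finite_all)
  then have "AE \<omega> in M. (\<Sum>i\<in>B. S i \<omega>) \<le> z"
    by eventually_elim (auto simp: True min_def split: if_splits intro!: sum_nonpos)
  moreover have [measurable]: "S i \<in> borel_measurable M" if "i \<in> B" for i
    using B that by (auto intro: measurable_size)
  ultimately have "prob {\<omega> \<in> space M. (\<Sum>i\<in>B. S i \<omega>) \<le> z} = 1"
    by (intro prob_eq_1[THEN iffD2]) auto
  then show ?thesis using \<alpha> by simp
next
  case False
  let ?E = "{\<omega> \<in> space M. (\<Sum>i\<in>B. S i \<omega>) \<le> z}"
  have [measurable]: "S i \<in> borel_measurable M" if "i \<in> B" for i
    using B that by (auto intro: measurable_size)
  have "(1 - \<alpha>) * z \<le> (\<integral>\<omega>. max 0 (z - (\<Sum>i\<in>B. S i \<omega>)) \<partial>M)"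
    using B z(2) b by (rule expected_slack_ge)
  also have "\<dots> \<le> (\<integral>\<omega>. z * indicator ?E \<omega> \<partial>M)"
  proof (rule integral_mono_AE)
    show "AE \<omega> in M. max 0 (z - (\<Sum>i\<in>B. S i \<omega>)) \<le> z * indicator ?E \<omega>"
      using AE_sizes_nonneg AE_space
    proof eventually_elim
      case (elim \<omega>)
      then have "0 \<le> (\<Sum>i\<in>B. S i \<omega>)" using B by (intro sum_nonneg) auto
      then show ?case using elim z by (auto simp: indicator_def)
    qed
  next
    show "integrable M (\<lambda>\<omega>. z * indicator ?E \<omega>)"
      by (intro integrable_mult_right integrable_real_indicator) (auto simp: emeasure_eq_measure)
  qed (rule expected_slack_ge(2)[OF B z(2) b])
  also have "\<dots> = z * prob ?E" by simp
  finally show ?thesis using z(1) False by (simp add: mult.commute)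
qed

section \<open>Conditioning on the outcome of one batch\<close>

lemma measurable_value:
  "set ls \<subseteq> I \<Longrightarrow>
    (\<lambda>\<omega>. risky_value v (\<lambda>i. S i \<omega>) (batch_policy \<mu> \<alpha>s ls y) y u) \<in> borel_measurable M"
  by (rule measurable_risky_value_batch_policy) (auto intro: measurable_size)

text \<open>Given the batch total, the remaining sizes are fresh, so \<open>later\<close> bounds the
  continuation. That bound is affine in the remaining capacity: its constant term is weighted by the
  probability of fitting, its linear term by the expected slack, and each estimate contributes a
  factor \<open>1 - \<alpha>\<close>.\<close>

lemma expectation_batch_step:
  fixes ls' :: "'i list"
  defines "V \<equiv> \<lambda>\<alpha>s ls y u. expectation (\<lambda>\<omega>. risky_value v (\<lambda>i. S i \<omega>) (batch_policy \<mu> \<alpha>s ls y) y u)"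
  assumes fill: "fill_batch \<mu> (\<alpha> * (1 - y)) [] ls = (B, ls')"
    and ls: "distinct ls" "set ls \<subseteq> I"
    and y: "0 \<le> y" "y \<le> 1" and \<alpha>: "0 \<le> \<alpha>" and u: "0 \<le> u"
    and pce: "0 \<le> p" "0 \<le> c" "0 \<le> e"
    and later: "\<And>y'. y \<le> y' \<Longrightarrow> y' \<le> 1 \<Longrightarrow>
      p * (u + sum v (set B)) + c * (1 - y') - e \<le> V \<alpha>s ls' y' (u + sum v (set B))"
  shows "(1 - \<alpha>) * (p * (u + sum v (set B)) + c * (1 - y)) - e \<le> V (\<alpha> # \<alpha>s) ls y u"
proof -
  have eq: "ls = B @ ls'" using fill_batch_append[OF fill] by simp
  have B: "set B \<subseteq> I" "distinct B" and ls': "set ls' \<subseteq> I" "set B \<inter> set ls' = {}"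
    using ls by (auto simp: eq)
  define u' where "u' = u + sum v (set B)"
  have u': "0 \<le> u'" using u B value_nonneg by (auto simp: u'_def intro!: add_nonneg_nonneg sum_nonneg)
  have b: "sum \<mu> (set B) \<le> \<alpha> * (1 - y)"
    using fill_batch_le[OF fill] y \<alpha> ls mean_truncated_size_nonneg by auto
  define X where "X = (\<lambda>\<omega>. \<Sum>i\<in>set B. S i \<omega>)"
  \<comment> \<open>\<open>Z\<close> and \<open>Y\<close> are the size vectors of the batch and of
    the remaining items, independent because the index sets are disjoint. The value is
    \<open>f\<close> of the batch total and the remaining sizes; \<open>g\<close> is
    \<open>f\<close> as a function of the two vectors, the form needed for Fubini.\<close>
  define Y where "Y = (\<lambda>\<omega>. restrict (\<lambda>i. S i \<omega>) (set ls'))"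
  define Z where "Z = (\<lambda>\<omega>. restrict (\<lambda>i. S i \<omega>) (set B))"
  define f where "f = (\<lambda>x s. if y + x > 1 then 0
    else risky_value v s (batch_policy \<mu> \<alpha>s ls' (y + x)) (y + x) u')"
  define g where "g = (\<lambda>(z, s). f (sum z (set B)) s)"
  have g_eq: "g (Z \<omega>, s) = f (X \<omega>) s" for \<omega> s
    by (simp add: g_def Z_def X_def)
  have [measurable]: "S i \<in> borel_measurable M" if "i \<in> set B" for i
    using B that by (auto intro: measurable_size)
  have [measurable]: "X \<in> borel_measurable M" unfolding X_def by measurable
  have indep: "indep_var (Pi\<^sub>M (set B) (\<lambda>_. borel)) Z (Pi\<^sub>M (set ls') (\<lambda>_. borel)) Y"
    unfolding Y_def Z_def using B ls' by (intro indep_var_restrict[OF sizes_indep]) auto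
  have g_meas: "g \<in> borel_measurable (Pi\<^sub>M (set B) (\<lambda>_. borel) \<Otimes>\<^sub>M Pi\<^sub>M (set ls') (\<lambda>_. borel))"
  proof -
    let ?N = "Pi\<^sub>M (set B) (\<lambda>_. borel) \<Otimes>\<^sub>M Pi\<^sub>M (set ls') (\<lambda>_. borel) :: (('i \<Rightarrow> real) \<times> ('i \<Rightarrow> real)) measure"
    have [measurable]: "(\<lambda>n. sum (fst n) (set B)) \<in> borel_measurable ?N"
      by measurable
    have [measurable]: "(\<lambda>n. risky_value v (snd n) (batch_policy \<mu> \<alpha>s ls' (y + sum (fst n) (set B)))
        (y + sum (fst n) (set B)) u') \<in> borel_measurable ?N"
      by (rule measurable_risky_value_batch_policy) measurable
    show ?thesis unfolding g_def f_def case_prod_beta by measurable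
  qed
  define C where "C = u' + sum_list (map v ls')"
  have bounds: "0 \<le> risky_value v s (batch_policy \<mu> \<alpha>s ls' y') y' u' \<and>
      risky_value v s (batch_policy \<mu> \<alpha>s ls' y') y' u' \<le> C" for s y'
    unfolding C_def using ls' value_nonneg u' by (intro risky_value_bounds) auto
  then have "0 \<le> C" by (meson order_trans)
  with bounds have g_bound: "\<bar>g z\<bar> \<le> C" for z
    by (auto simp: g_def f_def split: prod.splits)
  \<comment> \<open>For a fixed batch total without overflow, the inner expectation is that of the
    remaining policy, to which \<open>later\<close> applies.\<close>
  have inner: "(\<integral>\<omega>'. f x (Y \<omega>') \<partial>M) = (if y + x > 1 then 0 else V \<alpha>s ls' (y + x) u')" for x
  proof -
    have "risky_value v (Y \<omega>') (batch_policy \<mu> \<alpha>s ls' (y + x)) (y + x) u' =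
        risky_value v (\<lambda>i. S i \<omega>') (batch_policy \<mu> \<alpha>s ls' (y + x)) (y + x) u'" for \<omega>'
      by (rule risky_value_cong) (simp add: Y_def)
    then show ?thesis by (simp add: f_def V_def)
  qed
  have "V (\<alpha> # \<alpha>s) ls y u = (\<integral>\<omega>. f (X \<omega>) (Y \<omega>) \<partial>M)"
    unfolding V_def
  proof (rule integral_cong_AE)
    show "(\<lambda>\<omega>. risky_value v (\<lambda>i. S i \<omega>) (batch_policy \<mu> (\<alpha> # \<alpha>s) ls y) y u) \<in> borel_measurable M"
      using ls(2) by (rule measurable_value)
    show "(\<lambda>\<omega>. f (X \<omega>) (Y \<omega>)) \<in> borel_measurable M"
      unfolding g_eq[symmetric]
      using g_meas indep_var_rv1[OF indep] indep_var_rv2[OF indep] by measurable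
    \<comment> \<open>The equality is only almost sure: collapsing the batch to its total requires
      nonnegative sizes.\<close>
    show "AE \<omega> in M. risky_value v (\<lambda>i. S i \<omega>) (batch_policy \<mu> (\<alpha> # \<alpha>s) ls y) y u = f (X \<omega>) (Y \<omega>)"
      using AE_sizes_nonneg
    proof eventually_elim
      case (elim \<omega>)
      have "risky_value v (Y \<omega>) (batch_policy \<mu> \<alpha>s ls' (y + X \<omega>)) (y + X \<omega>) u' =
        risky_value v (\<lambda>i. S i \<omega>) (batch_policy \<mu> \<alpha>s ls' (y + X \<omega>)) (y + X \<omega>) u'"
        by (rule risky_value_cong) (simp add: Y_def)
      then show ?case
        unfolding risky_value_batch_policy_Cons fill prod.case
        using elim B y by (subst risky_value_foldr_Insert) (auto simp: f_def X_def u'_def)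
    qed
  qed
  also have "\<dots> = (\<integral>\<omega>. (\<integral>\<omega>'. f (X \<omega>) (Y \<omega>') \<partial>M) \<partial>M)"
    unfolding g_eq[symmetric] by (rule indep_var_iterated_integral[OF indep g_meas g_bound])
  finally have V_eq: "V (\<alpha> # \<alpha>s) ls y u = (\<integral>\<omega>. (\<integral>\<omega>'. f (X \<omega>) (Y \<omega>') \<partial>M) \<partial>M)" .
  have slack: "(1 - \<alpha>) * (1 - y) \<le> (\<integral>\<omega>. max 0 (1 - y - X \<omega>) \<partial>M)"
      "integrable M (\<lambda>\<omega>. max 0 (1 - y - X \<omega>))"
    unfolding X_def using expected_slack_ge[OF B(1) _ b] y by auto
  have fits: "1 - \<alpha> \<le> prob {\<omega> \<in> space M. X \<omega> \<le> 1 - y}"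
    unfolding X_def using y by (intro prob_batch_fits_ge[OF B(1) _ _ \<alpha> b]) auto
  have int: "integrable M (\<lambda>\<omega>. p * u' * indicator {\<omega> \<in> space M. X \<omega> \<le> 1 - y} \<omega>)"
      "integrable M (\<lambda>\<omega>. c * max 0 (1 - y - X \<omega>))"
    using slack(2)
    by (intro integrable_mult_right integrable_real_indicator; auto simp: emeasure_eq_measure)+
  have "(1 - \<alpha>) * (p * u' + c * (1 - y)) - e = p * u' * (1 - \<alpha>) + c * ((1 - \<alpha>) * (1 - y)) - e"
    by (simp add: algebra_simps)
  also have "\<dots> \<le> p * u' * prob {\<omega> \<in> space M. X \<omega> \<le> 1 - y} + c * (\<integral>\<omega>. max 0 (1 - y - X \<omega>) \<partial>M) - e"
    using fits slack(1) pce u' by (intro diff_right_mono add_mono mult_left_mono) auto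
  also have "\<dots> = (\<integral>\<omega>. p * u' * indicator {\<omega> \<in> space M. X \<omega> \<le> 1 - y} \<omega> + c * max 0 (1 - y - X \<omega>) - e \<partial>M)"
    using int by (simp add: prob_space)
  also have "\<dots> \<le> (\<integral>\<omega>. (\<integral>\<omega>'. f (X \<omega>) (Y \<omega>') \<partial>M) \<partial>M)"
  proof (rule integral_mono_AE)
    show "integrable M (\<lambda>\<omega>. \<integral>\<omega>'. f (X \<omega>) (Y \<omega>') \<partial>M)"
    proof (rule integrable_const_bound[where B = C])
      show "(\<lambda>\<omega>. \<integral>\<omega>'. f (X \<omega>) (Y \<omega>') \<partial>M) \<in> borel_measurable M"
        unfolding g_eq[symmetric] by (rule indep_var_iterated_integral[OF indep g_meas g_bound])
      have V_bound: "\<bar>V \<alpha>s ls' y' u'\<bar> \<le> C" for y'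
      proof -
        have "integrable M (\<lambda>\<omega>. risky_value v (\<lambda>i. S i \<omega>) (batch_policy \<mu> \<alpha>s ls' y') y' u')"
          using bounds measurable_value[OF ls'(1)] by (intro integrable_const_bound[where B = C]) auto
        then have "V \<alpha>s ls' y' u' \<le> C" unfolding V_def
          using bounds by (intro integral_le_const) auto
        moreover have "0 \<le> V \<alpha>s ls' y' u'"
          unfolding V_def using bounds by (intro integral_nonneg_AE) auto
        ultimately show ?thesis by simp
      qed
      show "AE \<omega> in M. norm (\<integral>\<omega>'. f (X \<omega>) (Y \<omega>') \<partial>M) \<le> C"
        using V_bound \<open>0 \<le> C\<close> by (simp add: inner)
    qed
    \<comment> \<open>If the batch fits, this is \<open>later\<close> at
      \<open>y + X \<omega>\<close>. On overflow only \<open>- e \<le> 0\<close> is left; the loss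
      \<open>e\<close> is thus charged in every outcome and carries no factor
      \<open>1 - \<alpha>\<close>.\<close>
    show "AE \<omega> in M. p * u' * indicator {\<omega> \<in> space M. X \<omega> \<le> 1 - y} \<omega> + c * max 0 (1 - y - X \<omega>) - e
        \<le> (\<integral>\<omega>'. f (X \<omega>) (Y \<omega>') \<partial>M)"
      using AE_sizes_nonneg AE_space
    proof eventually_elim
      case (elim \<omega>)
      have "0 \<le> X \<omega>" unfolding X_def using elim B by (intro sum_nonneg) auto
      then show ?case
        using later[of "y + X \<omega>"] elim y pce by (auto simp: inner u'_def[symmetric] algebra_simps)
    qed
  qed (intro Bochner_Integration.integrable_diff Bochner_Integration.integrable_add int integrable_const)
  finally show ?thesis unfolding V_eq u'_def .
qed

section \<open>Induction over the remaining batches\<close>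

text \<open>The reference budget \<open>T\<close> is kept apart from the planned budget
  \<open>real r * \<alpha> * (1 - y)\<close>: a batch lowers \<open>T\<close> by its actual mean
  size, whereas the planned budget depends on the observed size. The strict inequality keeps
  \<open>T\<close> positive throughout.\<close>

lemma batch_policy_value_ge:
  assumes \<alpha>: "0 \<le> \<alpha>" "\<alpha> \<le> 1" and \<epsilon>: "\<And>i. i \<in> I \<Longrightarrow> \<mu> i \<le> \<epsilon>" "0 \<le> \<epsilon>"
    and "distinct ls" "set ls \<subseteq> I" "density_sorted w \<mu> ls"
    and "0 \<le> y" "y \<le> 1" "0 \<le> u" "real r * \<alpha> * (1 - y) < T"
  shows "(1 - \<alpha>) ^ r * u +
      ((1 - \<alpha>) ^ r * (real r * \<alpha> * (1 - y)) - real r * \<epsilon>) * (fractional_opt (set ls) w \<mu> T / T)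
    \<le> expectation (\<lambda>\<omega>. risky_value v (\<lambda>i. S i \<omega>) (batch_policy \<mu> (replicate r \<alpha>) ls y) y u)"
  using assms(5-)
proof (induction r arbitrary: ls y u T)
  case 0
  then show ?case by (simp add: prob_space)
next
  case (Suc r)
  obtain B ls' where fill: "fill_batch \<mu> (\<alpha> * (1 - y)) [] ls = (B, ls')"
    by fastforce
  have ls: "ls = B @ ls'" using fill_batch_append[OF fill] by simp
  define b where "b = sum \<mu> (set B)"
  define q where "q = (1 - \<alpha>) ^ r"
  define t where "t = real r * \<alpha> * (1 - y)"
  define F where "F = fractional_opt (set ls) w \<mu> T"
  define F' where "F' = fractional_opt (set ls') w \<mu> (T - b)"
  have q: "0 \<le> q" "q \<le> 1" using \<alpha> by (auto simp: q_def power_le_one)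
  have t: "0 \<le> t" using \<alpha> Suc.prems by (simp add: t_def)
  have \<alpha>y: "0 \<le> \<alpha> * (1 - y)" using \<alpha> Suc.prems by simp
  have b_le: "b \<le> \<alpha> * (1 - y)" unfolding b_def
    using fill_batch_le[OF fill] \<alpha>y Suc.prems mean_truncated_size_nonneg by auto
  have b0: "0 \<le> b" unfolding b_def
    using Suc.prems mean_truncated_size_nonneg by (intro sum_nonneg) (auto simp: ls)
  have tT: "\<alpha> * (1 - y) + t < T" using Suc.prems by (simp add: t_def algebra_simps)
  have cross: "w j * \<mu> i \<le> w i * \<mu> j" if "i \<in> set B" "j \<in> set ls'" for i j
    using that Suc.prems(2,3) effective_value_nonneg mean_truncated_size_nonneg
    by (intro density_sorted_cross[of w \<mu> B ls']) (auto simp: ls)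
  have F_eq: "F = sum w (set B) + F'"
    unfolding F_def F'_def b_def ls set_append
    using Suc.prems(1,2) cross effective_value_nonneg mean_truncated_size_nonneg b_le tT t
    by (intro fractional_opt_Un) (auto simp: ls b_def)
  have F'_le: "b * F' \<le> sum w (set B) * (T - b)"
    unfolding b_def F'_def
    using cross effective_value_nonneg Suc.prems(2) b_le tT t
    by (intro fractional_opt_density_le) (auto simp: ls b_def)
  have T: "0 < T" "0 < T - b" "t < T - b" using tT t b_le \<alpha>y by auto
  have F'0: "0 \<le> F'" unfolding F'_def using T by (intro fractional_opt_nonneg) auto
  have F0: "0 \<le> F" unfolding F_def using T by (intro fractional_opt_nonneg) auto
  have W: "sum w (set B) \<le> sum v (set B)"
    using Suc.prems(2) by (intro sum_mono effective_value_le) (auto simp: ls)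
  \<comment> \<open>A mediant inequality: by \<open>F'_le\<close> the removed prefix is at least as
    dense as the average \<open>F' / (T - b)\<close> of the rest.\<close>
  have density: "F' / (T - b) \<le> F / T"
    using F'_le T by (simp add: F_eq field_simps)
  \<comment> \<open>\<open>c\<close> and \<open>e\<close> are the coefficients of the induction
    hypothesis read as an affine function of the remaining capacity \<open>1 - y'\<close>.\<close>
  define c where "c = q * (real r * \<alpha>) * (F' / (T - b))"
  define e where "e = real r * \<epsilon> * (F' / (T - b))"
  have "(1 - \<alpha>) * (q * (u + sum v (set B)) + c * (1 - y)) - e \<le>
    expectation (\<lambda>\<omega>. risky_value v (\<lambda>i. S i \<omega>) (batch_policy \<mu> (\<alpha> # replicate r \<alpha>) ls y) y u)"
  proof (rule expectation_batch_step[OF fill])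
    fix y' :: real assume y': "y \<le> y'" "y' \<le> 1"
    define u' where "u' = u + sum v (set B)"
    have "0 \<le> u'" unfolding u'_def using Suc.prems value_nonneg
      by (intro add_nonneg_nonneg sum_nonneg) (auto simp: ls)
    \<comment> \<open>A larger observed size only shrinks the planned budget, so the side condition
      of the induction hypothesis holds for \<open>T - b\<close> at every \<open>y'\<close>.\<close>
    have "real r * \<alpha> * (1 - y') \<le> t"
      unfolding t_def using \<alpha> y' by (intro mult_left_mono) auto
    then have "real r * \<alpha> * (1 - y') < T - b" using T by simp
    moreover have "distinct ls'" "set ls' \<subseteq> I" "density_sorted w \<mu> ls'"
      using Suc.prems by (auto simp: ls density_sorted_def sorted_wrt_append)
    ultimately have "(1 - \<alpha>) ^ r * u' +
        ((1 - \<alpha>) ^ r * (real r * \<alpha> * (1 - y')) - real r * \<epsilon>) * (F' / (T - b))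
      \<le> expectation (\<lambda>\<omega>. risky_value v (\<lambda>i. S i \<omega>) (batch_policy \<mu> (replicate r \<alpha>) ls' y') y' u')"
      unfolding F'_def using \<open>0 \<le> u'\<close> Suc.prems y' by (intro Suc.IH) auto
    also have "(1 - \<alpha>) ^ r * u' +
        ((1 - \<alpha>) ^ r * (real r * \<alpha> * (1 - y')) - real r * \<epsilon>) * (F' / (T - b)) = q * u' + c * (1 - y') - e"
      unfolding q_def[symmetric] c_def e_def left_diff_distrib[of _ _ "F' / (T - b)"] by simp
    finally show "q * (u + sum v (set B)) + c * (1 - y') - e \<le>
      expectation (\<lambda>\<omega>. risky_value v (\<lambda>i. S i \<omega>) (batch_policy \<mu> (replicate r \<alpha>) ls' y') y' (u + sum v (set B)))"
      by (simp only: u'_def)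
  qed (use Suc.prems \<alpha> q F'0 T \<epsilon> in \<open>auto simp: c_def e_def\<close>)
  moreover have "(1 - \<alpha>) ^ Suc r * u +
      ((1 - \<alpha>) ^ Suc r * (real (Suc r) * \<alpha> * (1 - y)) - real (Suc r) * \<epsilon>) * (F / T)
    \<le> (1 - \<alpha>) * (q * (u + sum v (set B)) + c * (1 - y)) - e"
  proof -
    define p where "p = (1 - \<alpha>) * q"
    define z where "z = \<alpha> * (1 - y)"
    define \<phi> where "\<phi> = F / T"
    define \<phi>' where "\<phi>' = F' / (T - b)"
    have p: "0 \<le> p" "p \<le> 1" using q \<alpha> by (auto simp: p_def intro: mult_le_one)
    have \<phi>: "0 \<le> \<phi>" "\<phi>' \<le> \<phi>" "F = \<phi> * T" "F' = \<phi>' * (T - b)"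
      using T F0 density by (auto simp: \<phi>_def \<phi>'_def)
    \<comment> \<open>The planned budget \<open>z + t\<close> at the old density is paid for by the
      batch value and the later budget \<open>t\<close> at the new density, up to a waste of
      \<open>\<epsilon>\<close>. If no item is left, the batch carries all of \<open>F\<close>;
      otherwise \<open>fill_batch_full\<close> gives \<open>z - \<epsilon> \<le> b\<close>.\<close>
    have "p * ((z + t) * \<phi>) - \<epsilon> * \<phi> \<le> p * (sum w (set B) + t * \<phi>')"
    proof (cases "ls' = []")
      case True
      then have "F' = 0" using T(2) by (simp add: F'_def fractional_opt_def feasible_fractional_def)
      then have "\<phi>' = 0" by (simp add: \<phi>'_def)
      have "(z + t) * \<phi> \<le> T * \<phi>" using tT \<phi> unfolding z_def by (intro mult_right_mono) auto
      then have "(z + t) * \<phi> \<le> sum w (set B)" using F_eq \<open>F' = 0\<close> \<phi>(3) by (simp add: mult.commute)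
      then have "p * ((z + t) * \<phi>) \<le> p * sum w (set B)" using p by (intro mult_left_mono) auto
      moreover have "0 \<le> \<epsilon> * \<phi>" using \<epsilon> \<phi> by simp
      ultimately show ?thesis using \<open>\<phi>' = 0\<close> by simp
    next
      case False
      then have "hd ls' \<in> I" using Suc.prems(2) by (auto simp: ls)
      then have "z - \<epsilon> \<le> b"
        using fill_batch_full[OF fill False] \<epsilon>(1)[of "hd ls'"] by (simp add: z_def b_def)
      then have "(z - \<epsilon> + t) * \<phi> \<le> (b + t) * \<phi>" using \<phi> by (intro mult_right_mono) auto
      also have "\<dots> \<le> sum w (set B) + t * \<phi>'"
      proof -
        \<comment> \<open>Since \<open>F = sum w (set B) + F'\<close>, the bound sought is
          \<open>\<phi> * T - \<phi>' * (T - b - t)\<close>, and replacing \<open>\<phi>'\<close> by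
          the larger \<open>\<phi>\<close> leaves \<open>(b + t) * \<phi>\<close>.\<close>
        have "(T - b - t) * \<phi>' \<le> (T - b - t) * \<phi>" using \<phi> T by (intro mult_left_mono) auto
        then show ?thesis using F_eq \<phi>(3,4) by (simp add: algebra_simps)
      qed
      finally have "p * ((z - \<epsilon> + t) * \<phi>) \<le> p * (sum w (set B) + t * \<phi>')"
        using p by (intro mult_left_mono) auto
      moreover have "p * (\<epsilon> * \<phi>) \<le> \<epsilon> * \<phi>" using p \<epsilon> \<phi> by (intro mult_left_le_one_le) auto
      ultimately show ?thesis by (simp add: algebra_simps)
    qed
    moreover have "p * sum w (set B) \<le> p * sum v (set B)" using W p(1) by (rule mult_left_mono)
    moreover have "real r * \<epsilon> * \<phi>' \<le> real r * \<epsilon> * \<phi>" using \<epsilon> \<phi> by (intro mult_left_mono) auto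
    moreover have "(1 - \<alpha>) * (q * (u + sum v (set B)) + c * (1 - y)) - e =
        p * u + p * sum v (set B) + p * (t * \<phi>') - real r * \<epsilon> * \<phi>'"
      by (simp add: p_def c_def e_def t_def \<phi>'_def[symmetric] algebra_simps)
    moreover have "(1 - \<alpha>) ^ Suc r * u +
        ((1 - \<alpha>) ^ Suc r * (real (Suc r) * \<alpha> * (1 - y)) - real (Suc r) * \<epsilon>) * (F / T) =
        p * u + (p * ((z + t) * \<phi>) - \<epsilon> * \<phi>) - real r * \<epsilon> * \<phi>"
      by (simp add: p_def q_def z_def t_def \<phi>_def[symmetric] algebra_simps)
    ultimately show ?thesis by (simp add: distrib_left)
  qed
  ultimately show ?case
    by (simp add: F_def)
qed

end

section \<open>The guarantee for the chosen parameters\<close>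

theorem mainTheorem6:
  fixes M :: "'a measure" and I :: "'i set" and v :: "'i \<Rightarrow> real" and S :: "'i \<Rightarrow> 'a \<Rightarrow> real"
    and \<epsilon> :: real and k m :: nat and w \<mu> :: "'i \<Rightarrow> real" and order :: "'i list"
  assumes "stochastic_knapsack M I v S"
    and "0 < \<epsilon>" and "\<epsilon> < 1"
    and "m = k + 1"
    and "w = effective_value M v S"
    and "\<mu> = mean_truncated_size M S"
    and "\<And>i. i \<in> I \<Longrightarrow> \<mu> i \<le> \<epsilon>"
    and "distinct order" and "set order = I" and "density_sorted w \<mu> order"
  shows "expected_risky_value M v S (batch_policy \<mu> (replicate m (1 / (real m + 1))) order 0)
    \<ge> fractional_opt I w \<mu> 1 * (((real k + 1) / (real k + 2)) ^ (k + 2) - (real k + 1) * \<epsilon>)"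
proof -
  interpret stochastic_knapsack M I v S by fact
  let ?\<alpha> = "1 / (real m + 1)"
  \<comment> \<open>This choice makes \<open>1 - ?\<alpha>\<close> and
    \<open>real m * ?\<alpha>\<close> the same number, so
    \<open>(1 - ?\<alpha>) ^ m * (real m * ?\<alpha>)\<close> is its power with exponent
    \<open>m + 1 = k + 2\<close>. As it is below \<open>1\<close>, the reference budget
    \<open>T = 1\<close> is admissible.\<close>
  have 1: "1 - ?\<alpha> = (real k + 1) / (real k + 2)" "real m * ?\<alpha> = (real k + 1) / (real k + 2)"
    using assms(4) by (auto simp: field_simps)
  have "fractional_opt I w \<mu> 1 * (((real k + 1) / (real k + 2)) ^ (k + 2) - (real k + 1) * \<epsilon>) =
      (1 - ?\<alpha>) ^ m * 0 + ((1 - ?\<alpha>) ^ m * (real m * ?\<alpha> * (1 - 0)) - real m * \<epsilon>) *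
      (fractional_opt (set order) w \<mu> 1 / 1)"
    unfolding 1 using assms(4,9) by (simp add: mult_ac add.commute)
  also have "\<dots> \<le>
      expectation (\<lambda>\<omega>. risky_value v (\<lambda>i. S i \<omega>) (batch_policy \<mu> (replicate m ?\<alpha>) order 0) 0 0)"
    unfolding assms(5,6) using assms
    by (intro batch_policy_value_ge) auto
  finally show ?thesis
    unfolding expected_risky_value_def .
qed

end
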